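(* Let $\alpha$ be a positive real number. Let $u:[0,1]\to\mathbb{R}$ be any function (no regularity assumed) such that $$u(1-x)+(1-x)^\alpha\, u\!\left(\frac{y}{1-x}\right) = u(y) + (1-y)^\alpha\, u\!\left(\frac{1-x-y}{1-y}\right)$$ for all $x,y\in[0,1)$ with $x+y\in[0,1]$. Then $u(x)=u(1-x)$ for all $x\in\mathbb{Q}\cap[0,1]$.
   Context: Since $\alpha>0$, $0^\alpha=0$. *)

theory Defs
  imports Complex_Main
begin

end

theory Submission
  imports Defs
begin

text \<open>
  Put \<open>F a b = (a + b) powr \<alpha> * u (a / (a + b))\<close>. Substituting \<open>x = p / s\<close>, \<open>y = q / s\<close> with
  \<open>s = p + q + r\<close> and multiplying by \<open>s powr \<alpha>\<close>, the functional equation becomes the 2-cocycle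
  equation \<open>F q r + F (q + r) p = F r p + F q (r + p)\<close> on the semigroup of positive reals. The
  antisymmetrization \<open>G a b = F a b - F b a\<close> of a cocycle on a commutative semigroup is biadditive,
  so \<open>G (k / n) (m / n) = k * m * G (1 / n) (1 / n) = 0\<close> for positive integers \<open>k, m, n\<close>.
  With \<open>k + m = n\<close> this says \<open>u (k / n) = u (1 - k / n)\<close>.
\<close>

text \<open>Add the cocycle equations at (a, b, c) and (c, a, b) and subtract the one at (a, c, b):
  since + is commutative, \<open>f a b\<close>, \<open>f (a + c) b\<close> and
  \<open>f a (b + c)\<close> cancel.\<close>

lemma cocycle_commutator_add_left:
  fixes f :: "real \<Rightarrow> real \<Rightarrow> real"
  assumes cocycle: "\<And>a b c. \<lbrakk>a > 0; b > 0; c > 0\<rbrakk> \<Longrightarrow> f a b + f (a + b) c = f b c + f a (b + c)"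
    and "a > 0" "b > 0" "c > 0"
  shows "f (a + b) c - f c (a + b) = (f a c - f c a) + (f b c - f c b)"
  using cocycle[of a b c] cocycle[of c a b] cocycle[of a c b] assms(2-)
  by (simp add: add.commute)

lemma cocycle_commutator_multiple_left:
  fixes f :: "real \<Rightarrow> real \<Rightarrow> real"
  assumes cocycle: "\<And>a b c. \<lbrakk>a > 0; b > 0; c > 0\<rbrakk> \<Longrightarrow> f a b + f (a + b) c = f b c + f a (b + c)"
    and "a > 0" "c > 0" "k \<ge> 1"
  shows "f (real k * a) c - f c (real k * a) = real k * (f a c - f c a)"
  using \<open>k \<ge> 1\<close>
proof (induction k rule: dec_induct)
  case base
  show ?case by simp
next
  case (step k)
  have "f (real k * a + a) c - f c (real k * a + a) =
      (f (real k * a) c - f c (real k * a)) + (f a c - f c a)"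
    using step.hyps assms(2,3) by (intro cocycle_commutator_add_left cocycle) auto
  with step.IH show ?case by (simp add: algebra_simps)
qed

lemma cocycle_commute_multiples:
  fixes f :: "real \<Rightarrow> real \<Rightarrow> real"
  assumes cocycle: "\<And>a b c. \<lbrakk>a > 0; b > 0; c > 0\<rbrakk> \<Longrightarrow> f a b + f (a + b) c = f b c + f a (b + c)"
    and "a > 0" "k \<ge> 1" "m \<ge> 1"
  shows "f (real k * a) (real m * a) = f (real m * a) (real k * a)"
proof -
  have "f (real k * a) (real m * a) - f (real m * a) (real k * a) =
      real k * (f a (real m * a) - f (real m * a) a)"
    using assms by (intro cocycle_commutator_multiple_left cocycle) auto
  \<comment> \<open>The commutator is antisymmetric, so additivity on the left also extracts the
    factor \<open>m\<close> from the right argument. What remains is the commutator of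
    \<open>a\<close> with itself.\<close>
  moreover have "f (real m * a) a - f a (real m * a) = real m * (f a a - f a a)"
    using assms by (intro cocycle_commutator_multiple_left cocycle) auto
  ultimately show ?thesis by simp
qed

theorem theorem1p3:
  fixes \<alpha> :: real and u :: "real \<Rightarrow> real"
  assumes "\<alpha> > 0"
    and "\<And>x y. x \<in> {0..<1} \<Longrightarrow> y \<in> {0..<1} \<Longrightarrow> x + y \<in> {0..1} \<Longrightarrow>
      u (1 - x) + (1 - x) powr \<alpha> * u (y / (1 - x)) =
      u y + (1 - y) powr \<alpha> * u ((1 - x - y) / (1 - y))"
  shows "\<forall>x \<in> \<rat> \<inter> {0..1}. u x = u (1 - x)"
proof
  define F where "F a b = (a + b) powr \<alpha> * u (a / (a + b))" for a b
  have cocycle: "F q r + F (q + r) p = F r p + F q (r + p)"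
    if "q > 0" "r > 0" "p > 0" for p q r
  proof -
    define s where "s = p + q + r"
    have s: "s > 0" using that by (simp add: s_def)
    have x: "1 - p / s = (q + r) / s" and y: "1 - q / s = (r + p) / s"
      using s by (simp_all add: s_def field_simps)
    have z: "1 - p / s - q / s = r / s"
      unfolding x by (simp flip: diff_divide_distrib)
    have ranges: "p / s \<in> {0..<1}" "q / s \<in> {0..<1}" "p / s + q / s \<in> {0..1}"
      using that s by (simp_all add: s_def flip: add_divide_distrib)
    have "u ((q + r) / s) + ((q + r) / s) powr \<alpha> * u (q / (q + r)) =
        u (q / s) + ((r + p) / s) powr \<alpha> * u (r / (r + p))"
      using assms(2)[OF ranges] s unfolding z unfolding x y by simp
    then have "s powr \<alpha> * (u ((q + r) / s) + ((q + r) / s) powr \<alpha> * u (q / (q + r))) =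
        s powr \<alpha> * (u (q / s) + ((r + p) / s) powr \<alpha> * u (r / (r + p)))"
      by simp
    then have "s powr \<alpha> * u ((q + r) / s) + (q + r) powr \<alpha> * u (q / (q + r)) =
        s powr \<alpha> * u (q / s) + (r + p) powr \<alpha> * u (r / (r + p))"
      using s that by (simp add: powr_divide distrib_left)
    \<comment> \<open>Both \<open>F (q + r) p\<close> and \<open>F q (r + p)\<close> have total
      \<open>s\<close>, so they are the two terms carrying \<open>s powr \<alpha>\<close>.\<close>
    moreover have "q + r + p = s" "q + (r + p) = s" by (simp_all add: s_def)
    ultimately show ?thesis unfolding F_def by (simp only: add.commute)
  qed
  \<comment> \<open>The cocycle equation covers only positive arguments, so the endpoints are
    treated directly. At x = 0, y = 1/2 the terms \<open>u (1 / 2)\<close> cancel, leaving u(1) =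
    (1/2)^\<alpha> u(1); at x = y = 1/2 the equation reduces to u(1) = u(0).\<close>
  have half: "(1 / 2) powr \<alpha> \<noteq> (1 :: real)" "(1 / 2) powr \<alpha> \<noteq> (0 :: real)"
    using assms(1) by (simp_all add: powr_divide)
  have u1: "u 1 = 0"
    using assms(2)[of 0 "1 / 2"] half by simp
  have u0: "u 0 = 0"
    using assms(2)[of "1 / 2" "1 / 2"] half u1 by simp
  fix x :: real
  assume x: "x \<in> \<rat> \<inter> {0..1}"
  show "u x = u (1 - x)"
  proof (cases "x = 0 \<or> x = 1")
    case True
    with u0 u1 show ?thesis by auto
  next
    case False
    obtain k n :: nat where n: "n \<noteq> 0" and "\<bar>x\<bar> = real k / real n"
      using x Rats_abs_nat_div_natE by (metis IntD1)
    with x have xkn: "x = real k / real n" by simp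
    with False x n have k: "1 \<le> k" "k < n"
      by (auto simp: field_simps Suc_le_eq intro: Nat.gr0I)
    have "F (real k * (1 / real n)) (real (n - k) * (1 / real n)) =
        F (real (n - k) * (1 / real n)) (real k * (1 / real n))"
      using n k by (intro cocycle_commute_multiples cocycle) auto
    moreover have "real k * (1 / real n) = x" "real (n - k) * (1 / real n) = 1 - x"
      using xkn n k by (simp_all add: of_nat_diff field_simps)
    ultimately have "F x (1 - x) = F (1 - x) x" by simp
    \<comment> \<open>The arguments sum to 1, so the power factor is 1 and
      \<open>F x (1 - x)\<close> is just \<open>u x\<close>.\<close>
    then show ?thesis by (simp add: F_def)
  qed
qed

end
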